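(* Let $M=\begin{pmatrix}\gamma_1&0\\0&\gamma_2\end{pmatrix}$, $\gamma_1,\gamma_2\in\mathbb Z$, be a matrix dilation and $n\in\mathbb N$. Then there exists a mask $m_0$ that is axial symmetric with respect to the origin and has sum rule of order $n$ (with respect to $M$).
   Context: A matrix dilation $M$ is an integer matrix all of whose eigenvalues are bigger than 1 in modulus; $M^*$ is its conjugate (transpose). A mask is a trigonometric polynomial $m_0(\xi)=\sum_{k\in\mathbb Z^2}h_ke^{2\pi i(k,\xi)}$ (finite sum, $h_k\in\mathbb C$, $\xi\in\mathbb R^2$) with $m_0(\mathbf 0)=1$. The axial symmetry group is $G^{axis}=\{\pm I_2,\pm Y\}$, $Y=\begin{pmatrix}-1&0\\0&1\end{pmatrix}$. A trigonometric polynomial $t$ is axial symmetric with respect to a center $c\in\frac12\mathbb Z^2$ if $t(\xi)=e^{2\pi i(c-Ec,\xi)}t(E^*\xi)$ for all $E\in G^{axis}$. $t$ has sum rule of order $n$ with respect to $M$ if $D^\beta(t(M^{*-1}\xi))|_{\xi=s}=0$ for all $s\in D(M^* )\setminus\{\mathbf 0\}$ and all $\beta\in\mathbb Z^2_+$ with $\beta_1+\beta_2<n$, where $D(M^* )$ is a complete set of representatives of $\mathbb Z^2/M^*\mathbb Z^2$ containing $\mathbf 0$. *)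

theory Defs
  imports "HOL-Analysis.Analysis"
begin

definition eigenvalue :: "complex^'n^'n \<Rightarrow> complex \<Rightarrow> bool" where
  "eigenvalue A l \<longleftrightarrow> (\<exists>v. v \<noteq> 0 \<and> A *v v = l *s v)"

definition matrix_dilation :: "int^2^2 \<Rightarrow> bool" where
  "matrix_dilation M \<longleftrightarrow> (\<forall>l. eigenvalue (map_matrix complex_of_int M) l \<longrightarrow> cmod l > 1)"

abbreviation real_mat :: "int^2^2 \<Rightarrow> real^2^2" where
  "real_mat A \<equiv> map_matrix real_of_int A"

abbreviation real_vec :: "int^2 \<Rightarrow> real^2" where
  "real_vec k \<equiv> (\<chi> i. real_of_int (k $ i))"

definition trig_poly :: "(real^2 \<Rightarrow> complex) \<Rightarrow> bool" where
  "trig_poly t \<longleftrightarrow> (\<exists>h :: int^2 \<Rightarrow> complex. finite {k. h k \<noteq> 0} \<and>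
     (\<forall>\<xi>. t \<xi> = (\<Sum>k | h k \<noteq> 0. h k * exp (2 * of_real pi * \<i> * of_real (real_vec k \<bullet> \<xi>)))))"

definition is_mask :: "(real^2 \<Rightarrow> complex) \<Rightarrow> bool" where
  "is_mask t \<longleftrightarrow> trig_poly t \<and> t 0 = 1"

definition Y_mat :: "int^2^2" where
  "Y_mat = vector [vector [-1, 0], vector [0, 1]]"

definition G_axis :: "(int^2^2) set" where
  "G_axis = {mat 1, - mat 1, Y_mat, - Y_mat}"

definition axial_symmetric :: "(real^2 \<Rightarrow> complex) \<Rightarrow> real^2 \<Rightarrow> bool" where
  "axial_symmetric t c \<longleftrightarrow> (\<exists>k :: int^2. c = (1/2) *\<^sub>R real_vec k) \<and>
     (\<forall>E\<in>G_axis. \<forall>\<xi>.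
        t \<xi> = exp (2 * of_real pi * \<i> * of_real ((c - real_mat E *v c) \<bullet> \<xi>))
               * t (real_mat (transpose E) *v \<xi>))"

definition partial_deriv :: "2 \<Rightarrow> (real^2 \<Rightarrow> complex) \<Rightarrow> real^2 \<Rightarrow> complex" where
  "partial_deriv j f x = vector_derivative (\<lambda>u. f (x + u *\<^sub>R axis j 1)) (at 0)"

definition multi_deriv :: "nat^2 \<Rightarrow> (real^2 \<Rightarrow> complex) \<Rightarrow> real^2 \<Rightarrow> complex" where
  "multi_deriv \<beta> f = (partial_deriv 1 ^^ (\<beta> $ 1)) ((partial_deriv 2 ^^ (\<beta> $ 2)) f)"

definition digit_set :: "int^2^2 \<Rightarrow> (int^2) set \<Rightarrow> bool" where
  "digit_set A D \<longleftrightarrow> 0 \<in> D \<and> (\<forall>x. \<exists>!d. d \<in> D \<and> (\<exists>z. x - d = A *v z))"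

(* For a trigonometric polynomial and an invertible M, the vanishing condition at s depends only
   on the class of s modulo transpose M, by periodicity; so requiring it for every digit set
   agrees with requiring it for a fixed one.  Digit sets exist by ex_digit_set below. *)
definition sum_rule :: "int^2^2 \<Rightarrow> nat \<Rightarrow> (real^2 \<Rightarrow> complex) \<Rightarrow> bool" where
  "sum_rule M n t \<longleftrightarrow> (\<forall>D. digit_set (transpose M) D \<longrightarrow>
     (\<forall>s \<in> D - {0}. \<forall>\<beta> :: nat^2. \<beta> $ 1 + \<beta> $ 2 < n \<longrightarrow>
        multi_deriv \<beta> (\<lambda>\<xi>. t (matrix_inv (real_mat (transpose M)) *v \<xi>)) (real_vec s) = 0))"

lemma ex_digit_set: "\<exists>D. digit_set A D"
proof -
  define R where "R x y \<longleftrightarrow> (\<exists>z. x - y = A *v z)" for x y :: "int^2"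
  have refl: "R x x" for x
    unfolding R_def by (intro exI[of _ 0]) simp
  have sym: "R y x" if xy: "R x y" for x y
  proof -
    from xy obtain z where "x - y = A *v z" unfolding R_def by blast
    then have "y - x = A *v (0 - z)"
      by (simp only: matrix_vector_mult_diff_distrib) (simp add: algebra_simps)
    then show ?thesis unfolding R_def by blast
  qed
  have trans: "R x w" if xy: "R x y" and yw: "R y w" for x y w
  proof -
    from xy yw obtain z z' where "x - y = A *v z" "y - w = A *v z'" unfolding R_def by blast
    then have "x - w = A *v (z + z')"
      by (simp add: matrix_vector_right_distrib flip: \<open>x - y = A *v z\<close> \<open>y - w = A *v z'\<close>)
    then show ?thesis unfolding R_def by blast
  qed
  define r where "r x = (if R x 0 then 0 else (SOME y. R x y))" for x
  have R_r: "R x (r x)" for x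
    using refl[of x] by (auto simp: r_def intro: someI[where P = "R x"])
  have r_eq: "r x = r y" if "R x y" for x y
  proof -
    have "R x = R y"
      using that sym trans by blast
    then show ?thesis by (simp add: r_def)
  qed
  have "\<exists>!d. d \<in> range r \<and> R x d" for x
  proof (rule ex1I[of _ "r x"])
    fix d assume "d \<in> range r \<and> R x d"
    then obtain y where d: "d = r y" "R x (r y)" by blast
    then have "R x y" using R_r sym trans by blast
    then show "d = r x" using r_eq d by simp
  qed (simp add: R_r)
  moreover have "0 \<in> range r"
    using refl[of 0] by (intro range_eqI[of _ _ 0]) (simp add: r_def)
  ultimately have "digit_set A (range r)"
    by (simp add: digit_set_def R_def)
  then show ?thesis ..
qed

end

theory Submission
  imports Defs
begin

text \<open>
  For an integer \<open>g \<ge> 1\<close> the normalized geometric sum \<open>g\<^sup>-\<^sup>1 (1 + w + \<dots> + w\<^sup>g\<^sup>-\<^sup>1)\<close> with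
  \<open>w = exp (2\<pi>ix)\<close> equals 1 at \<open>x = 0\<close> and vanishes at every multiple of \<open>1/g\<close> that
  is not an integer, because there \<open>w\<close> is a root of unity different from 1.  In general it is not
  even in \<open>x\<close>, but its product with its reflection is: this is the Fejer kernel \<open>fejer g\<close>.

  A point \<open>s \<in> \<int>\<^sup>2\<close> outside \<open>M\<^sup>*\<int>\<^sup>2\<close>, where \<open>M = diag (\<gamma>\<^sub>1, \<gamma>\<^sub>2)\<close> with nonzero
  entries, has a coordinate \<open>s\<^sub>i\<close> that is
  not divisible by \<open>\<gamma>\<^sub>i\<close>, so \<open>fejer \<bar>\<gamma>\<^sub>i\<bar> (s\<^sub>i/\<gamma>\<^sub>i) = 0\<close>.  Hence the tensor product
  \<open>P \<xi> = fejer \<bar>\<gamma>\<^sub>1\<bar> \<xi>\<^sub>1 * fejer \<bar>\<gamma>\<^sub>2\<bar> \<xi>\<^sub>2\<close> satisfies \<open>P 0 = 1\<close>, is even in each variable, which is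
  axial symmetry about the origin, and vanishes at \<open>M\<^sup>*\<^sup>-\<^sup>1s\<close>.  The mask is \<open>P ^ n\<close>.

  The sum rule follows since each partial derivative lowers the power of \<open>q \<xi> = P (M\<^sup>*\<^sup>-\<^sup>1\<xi>)\<close> by at
  most one (\<open>partial_deriv_power_factor\<close>), so that a derivative of \<open>q ^ n\<close> of order below \<open>n\<close> still
  contains a factor \<open>q\<close>.  The product rule needs all functions involved to be differentiable
  arbitrarily often; this is ensured by working in the algebra \<open>exp_poly\<close> generated by the exponentials
  with arbitrary real frequencies, which is closed under partial derivatives and linear
  substitutions, while \<open>\<xi> \<mapsto> P (M\<^sup>*\<^sup>-\<^sup>1\<xi>)\<close> in general does not have integral frequencies.
\<close>

section \<open>Characters and trigonometric polynomials\<close>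

definition char1 :: "real \<Rightarrow> complex" where
  "char1 x = exp (2 * of_real pi * \<i> * of_real x)"

lemma char1_0 [simp]: "char1 0 = 1"
  by (simp add: char1_def)

lemma char1_add: "char1 (x + y) = char1 x * char1 y"
  by (simp add: char1_def ring_distribs exp_add)

lemma char1_of_nat_mult: "char1 (of_nat j * x) = char1 x ^ j"
  by (simp add: char1_def exp_of_nat_mult [symmetric] mult_ac)

lemma char1_eq_1_iff: "char1 x = 1 \<longleftrightarrow> x \<in> \<int>"
proof -
  have "char1 x = 1 \<longleftrightarrow> (\<exists>k::int. x = of_int k)"
    by (simp add: char1_def exp_eq_1 mult.commute)
  then show ?thesis
    by (auto elim!: Ints_cases)
qed

text \<open>
  Frequencies may be repeated here, which makes products immediate: collecting equal frequencies
  yields the canonical coefficients.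
\<close>

lemma trig_polyI:
  fixes c :: "'a \<Rightarrow> complex" and f :: "'a \<Rightarrow> int^2"
  assumes A: "finite A" and t: "\<And>\<xi>. t \<xi> = (\<Sum>a\<in>A. c a * char1 (real_vec (f a) \<bullet> \<xi>))"
  shows "trig_poly t"
proof -
  define h where "h k = (\<Sum>a\<in>{a\<in>A. f a = k}. c a)" for k
  have sub: "{k. h k \<noteq> 0} \<subseteq> f ` A"
  proof
    fix k assume "k \<in> {k. h k \<noteq> 0}"
    then have "{a\<in>A. f a = k} \<noteq> {}"
      unfolding h_def by (metis (mono_tags, lifting) mem_Collect_eq sum.empty)
    then show "k \<in> f ` A" by auto
  qed
  have fin: "finite {k. h k \<noteq> 0}"
    using sub A by (meson finite_imageI finite_subset)
  have "t \<xi> = (\<Sum>k | h k \<noteq> 0. h k * char1 (real_vec k \<bullet> \<xi>))" for \<xi>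
  proof -
    have "t \<xi> = (\<Sum>k\<in>f ` A. \<Sum>a\<in>{a\<in>A. f a = k}. c a * char1 (real_vec (f a) \<bullet> \<xi>))"
      unfolding t by (rule sum.image_gen [OF A])
    also have "\<dots> = (\<Sum>k\<in>f ` A. h k * char1 (real_vec k \<bullet> \<xi>))"
      unfolding h_def sum_distrib_right by (intro sum.cong) auto
    also have "\<dots> = (\<Sum>k | h k \<noteq> 0. h k * char1 (real_vec k \<bullet> \<xi>))"
      using sub A by (intro sum.mono_neutral_right) auto
    finally show ?thesis .
  qed
  with fin show ?thesis
    unfolding trig_poly_def char1_def by blast
qed

lemma trig_poly_const: "trig_poly (\<lambda>\<xi>. c)"
  by (rule trig_polyI [of "{()}" _ "\<lambda>_. c" "\<lambda>_. 0"]) (simp_all add: inner_vec_def)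

lemma trig_poly_mult:
  assumes "trig_poly s" "trig_poly t"
  shows "trig_poly (\<lambda>\<xi>. s \<xi> * t \<xi>)"
proof -
  obtain g where g: "finite {k. g k \<noteq> 0}"
      "\<And>\<xi>. s \<xi> = (\<Sum>k | g k \<noteq> 0. g k * char1 (real_vec k \<bullet> \<xi>))"
    using assms(1) unfolding trig_poly_def char1_def by blast
  obtain h where h: "finite {k. h k \<noteq> 0}"
      "\<And>\<xi>. t \<xi> = (\<Sum>k | h k \<noteq> 0. h k * char1 (real_vec k \<bullet> \<xi>))"
    using assms(2) unfolding trig_poly_def char1_def by blast
  have char1_real_vec_add: "char1 (real_vec (k + l) \<bullet> \<xi>)
      = char1 (real_vec k \<bullet> \<xi>) * char1 (real_vec l \<bullet> \<xi>)" for k l :: "int^2" and \<xi>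
    by (simp add: inner_vec_def sum_2 ring_distribs char1_add)
  show ?thesis
  proof (rule trig_polyI)
    show "finite ({k. g k \<noteq> 0} \<times> {k. h k \<noteq> 0})"
      using g(1) h(1) by blast
    show "s \<xi> * t \<xi> = (\<Sum>p\<in>{k. g k \<noteq> 0} \<times> {k. h k \<noteq> 0}.
        (g (fst p) * h (snd p)) * char1 (real_vec (fst p + snd p) \<bullet> \<xi>))" for \<xi>
      unfolding g(2) h(2) sum_product sum.cartesian_product
      by (intro sum.cong) (auto simp only: split_beta fst_conv snd_conv char1_real_vec_add mult_ac)
  qed
qed

lemma trig_poly_power:
  assumes "trig_poly t"
  shows "trig_poly (\<lambda>\<xi>. t \<xi> ^ n)"
  by (induction n) (auto intro: trig_poly_const trig_poly_mult assms)

section \<open>Derivatives of exponential polynomials\<close>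

text \<open>
  Generating the class by products as well as sums reduces each closure property, in particular
  that under differentiation, to the single exponentials.
\<close>

inductive exp_poly :: "(real^2 \<Rightarrow> complex) \<Rightarrow> bool" where
  exp_poly_char1: "exp_poly (\<lambda>\<xi>. c * char1 (a \<bullet> \<xi>))"
| exp_poly_add: "exp_poly f \<Longrightarrow> exp_poly g \<Longrightarrow> exp_poly (\<lambda>\<xi>. f \<xi> + g \<xi>)"
| exp_poly_mult: "exp_poly f \<Longrightarrow> exp_poly g \<Longrightarrow> exp_poly (\<lambda>\<xi>. f \<xi> * g \<xi>)"

lemma exp_poly_const: "exp_poly (\<lambda>\<xi>. c)"
  using exp_poly_char1 [of c 0] by simp

lemma exp_poly_power: "exp_poly f \<Longrightarrow> exp_poly (\<lambda>\<xi>. f \<xi> ^ k)"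
  by (induction k) (auto intro: exp_poly_const exp_poly_mult)

lemma exp_poly_sum:
  assumes "\<And>a. a \<in> A \<Longrightarrow> exp_poly (f a)"
  shows "exp_poly (\<lambda>\<xi>. \<Sum>a\<in>A. f a \<xi>)"
  using assms
  by (induction A rule: infinite_finite_induct) (auto intro: exp_poly_const exp_poly_add)

lemma trig_poly_imp_exp_poly:
  assumes "trig_poly t"
  shows "exp_poly t"
proof -
  obtain h where "\<And>\<xi>. t \<xi> = (\<Sum>k | h k \<noteq> 0. h k * char1 (real_vec k \<bullet> \<xi>))"
    using assms unfolding trig_poly_def char1_def by blast
  then have "t = (\<lambda>\<xi>. \<Sum>k | h k \<noteq> 0. h k * char1 (real_vec k \<bullet> \<xi>))" by auto
  then show ?thesis
    by (simp add: exp_poly_sum exp_poly_char1)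
qed

lemma exp_poly_matrix_vector_mult:
  assumes "exp_poly f"
  shows "exp_poly (\<lambda>\<xi>. f (A *v \<xi>))"
  using assms
proof induction
  case (exp_poly_char1 c a)
  have "a \<bullet> (A *v \<xi>) = (transpose A *v a) \<bullet> \<xi>" for \<xi>
    by (simp add: dot_lmul_matrix [symmetric] transpose_matrix_vector)
  then show ?case
    by (simp add: exp_poly.exp_poly_char1)
qed (auto intro: exp_poly.intros)

lemma exp_poly_has_partial_deriv_ex:
  assumes "exp_poly f"
  shows "\<exists>f'. exp_poly f' \<and>
    (\<forall>x. ((\<lambda>u. f (x + u *\<^sub>R axis j 1)) has_vector_derivative f' x) (at 0))"
  using assms
proof induction
  case (exp_poly_char1 c a)
  define d where "d = c * (2 * of_real pi * \<i> * of_real (a $ j))"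
  have "((\<lambda>u. c * char1 (a \<bullet> (x + u *\<^sub>R axis j 1))) has_vector_derivative
      d * char1 (a \<bullet> x)) (at 0)" for x
  proof -
    \<comment> \<open>The exponential is differentiated along a complex parameter and restricted to real values.\<close>
    have "((\<lambda>z. c * exp (2 * of_real pi * \<i> * (of_real (a \<bullet> x) + z * of_real (a $ j))))
        has_field_derivative d * char1 (a \<bullet> x)) (at (of_real 0))"
      by (auto intro!: derivative_eq_intros simp: d_def char1_def)
    from has_vector_derivative_real_field [OF this]
    show ?thesis
      by (simp add: char1_def inner_add_right inner_axis)
  qed
  then show ?case
    by (intro exI [of _ "\<lambda>\<xi>. d * char1 (a \<bullet> \<xi>)"]) (auto intro: exp_poly.exp_poly_char1)
next
  case (exp_poly_add f g)
  then obtain f' g' where "exp_poly f'" "exp_poly g'"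
    "\<And>x. ((\<lambda>u. f (x + u *\<^sub>R axis j 1)) has_vector_derivative f' x) (at 0)"
    "\<And>x. ((\<lambda>u. g (x + u *\<^sub>R axis j 1)) has_vector_derivative g' x) (at 0)"
    by blast
  then show ?case
    by (intro exI [of _ "\<lambda>\<xi>. f' \<xi> + g' \<xi>"] conjI allI exp_poly.exp_poly_add
        has_vector_derivative_add)
next
  case (exp_poly_mult f g)
  then obtain f' g' where *: "exp_poly f'" "exp_poly g'"
    "\<And>x. ((\<lambda>u. f (x + u *\<^sub>R axis j 1)) has_vector_derivative f' x) (at 0)"
    "\<And>x. ((\<lambda>u. g (x + u *\<^sub>R axis j 1)) has_vector_derivative g' x) (at 0)"
    by blast
  have "((\<lambda>u. f (x + u *\<^sub>R axis j 1) * g (x + u *\<^sub>R axis j 1))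
      has_vector_derivative f x * g' x + f' x * g x) (at 0)" for x
    using has_vector_derivative_mult [OF *(3,4)] by simp
  then show ?case
    using * exp_poly_mult.hyps
    by (intro exI [of _ "\<lambda>\<xi>. f \<xi> * g' \<xi> + f' \<xi> * g \<xi>"] conjI allI
        exp_poly.exp_poly_add exp_poly.exp_poly_mult)
qed

lemma
  assumes "exp_poly f"
  shows exp_poly_partial_deriv: "exp_poly (partial_deriv j f)"
    and exp_poly_has_partial_deriv:
      "((\<lambda>u. f (x + u *\<^sub>R axis j 1)) has_vector_derivative partial_deriv j f x) (at 0)"
proof -
  obtain f' where f': "exp_poly f'"
    "\<And>x. ((\<lambda>u. f (x + u *\<^sub>R axis j 1)) has_vector_derivative f' x) (at 0)"
    using exp_poly_has_partial_deriv_ex [OF assms] by blast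
  then have "partial_deriv j f = f'"
    by (auto simp: partial_deriv_def vector_derivative_at)
  with f' show "exp_poly (partial_deriv j f)"
    "((\<lambda>u. f (x + u *\<^sub>R axis j 1)) has_vector_derivative partial_deriv j f x) (at 0)"
    by auto
qed

text \<open>
  The derivative has the factor \<open>q\<^sup>k\<close>, for by the product rule
  \<open>\<partial>(q\<^sup>k\<^sup>+\<^sup>1 r) = q\<^sup>k ((k + 1) (\<partial>q) r + q (\<partial>r))\<close>.
  The cofactor is kept arbitrary so that the step can be iterated.
\<close>

lemma partial_deriv_power_factor:
  assumes q: "exp_poly q" and r: "exp_poly r"
  shows "\<exists>r'. exp_poly r' \<and> partial_deriv j (\<lambda>\<xi>. q \<xi> ^ Suc k * r \<xi>) = (\<lambda>\<xi>. q \<xi> ^ k * r' \<xi>)"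
proof -
  define r' where
    "r' \<xi> = q \<xi> * partial_deriv j r \<xi> + (of_nat (Suc k) * partial_deriv j q \<xi>) * r \<xi>" for \<xi>
  have "exp_poly r'"
    unfolding r'_def
    by (intro exp_poly_add exp_poly_mult exp_poly_const q r exp_poly_partial_deriv)
  moreover have "partial_deriv j (\<lambda>\<xi>. q \<xi> ^ Suc k * r \<xi>) x = q x ^ k * r' x" for x
  proof -
    have pow: "((\<lambda>u. q (x + u *\<^sub>R axis j 1) ^ m) has_vector_derivative
        of_nat m * q x ^ (m - 1) * partial_deriv j q x) (at 0)" for m
    proof -
      have "((\<lambda>z. z ^ m) has_field_derivative of_nat m * q x ^ (m - 1))
          (at (q (x + 0 *\<^sub>R axis j 1)))"
        by (auto intro!: derivative_eq_intros)
      from field_vector_diff_chain_at [OF exp_poly_has_partial_deriv [OF q] this]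
      show ?thesis by (simp add: o_def mult_ac)
    qed
    show ?thesis
      unfolding partial_deriv_def
      using has_vector_derivative_mult
        [OF pow [of "Suc k"] exp_poly_has_partial_deriv [OF r, of x j]]
      by (intro vector_derivative_at) (simp add: r'_def algebra_simps)
  qed
  ultimately show ?thesis by blast
qed

lemma iterated_partial_deriv_power_factor:
  assumes "exp_poly q" "exp_poly r" "m \<le> k"
  shows "\<exists>r'. exp_poly r' \<and>
    (partial_deriv j ^^ m) (\<lambda>\<xi>. q \<xi> ^ k * r \<xi>) = (\<lambda>\<xi>. q \<xi> ^ (k - m) * r' \<xi>)"
  using \<open>m \<le> k\<close>
proof (induction m)
  case 0
  show ?case using assms by auto
next
  case (Suc m)
  then obtain r' where r': "exp_poly r'"
    "(partial_deriv j ^^ m) (\<lambda>\<xi>. q \<xi> ^ k * r \<xi>) = (\<lambda>\<xi>. q \<xi> ^ (k - m) * r' \<xi>)"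
    by auto
  moreover have "k - m = Suc (k - Suc m)"
    using Suc.prems by simp
  ultimately show ?case
    using partial_deriv_power_factor [OF assms(1) r'(1), of j "k - Suc m"] by simp
qed

text \<open>Fewer than \<open>n\<close> derivatives leave a positive power of \<open>q\<close>, which vanishes with \<open>q\<close>.\<close>

lemma multi_deriv_power_eq_0:
  assumes q: "exp_poly q" and "q x = 0" and order: "\<beta> $ 1 + \<beta> $ 2 < n"
  shows "multi_deriv \<beta> (\<lambda>\<xi>. q \<xi> ^ n) x = 0"
proof -
  obtain r where r: "exp_poly r"
    "(partial_deriv 2 ^^ (\<beta> $ 2)) (\<lambda>\<xi>. q \<xi> ^ n * 1) = (\<lambda>\<xi>. q \<xi> ^ (n - \<beta> $ 2) * r \<xi>)"
    using iterated_partial_deriv_power_factor [OF q exp_poly_const, of "\<beta> $ 2" n 2 1] order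
    by auto
  have "\<beta> $ 1 \<le> n - \<beta> $ 2"
    using order by linarith
  then obtain r' where
    "(partial_deriv 1 ^^ (\<beta> $ 1)) (\<lambda>\<xi>. q \<xi> ^ (n - \<beta> $ 2) * r \<xi>)
      = (\<lambda>\<xi>. q \<xi> ^ (n - \<beta> $ 2 - \<beta> $ 1) * r' \<xi>)"
    using iterated_partial_deriv_power_factor [OF q r(1), of "\<beta> $ 1" "n - \<beta> $ 2" 1]
    by blast
  then have "multi_deriv \<beta> (\<lambda>\<xi>. q \<xi> ^ n) x = q x ^ (n - \<beta> $ 2 - \<beta> $ 1) * r' x"
    using r(2) by (simp add: multi_deriv_def)
  then show ?thesis
    using assms by simp
qed

section \<open>The Fejer kernel\<close>

definition geom_char :: "nat \<Rightarrow> real \<Rightarrow> complex" where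
  "geom_char g x = (\<Sum>j<g. char1 (of_nat j * x))"

definition fejer :: "nat \<Rightarrow> real \<Rightarrow> complex" where
  "fejer g x = geom_char g x * geom_char g (- x) / of_nat g ^ 2"

lemma fejer_minus [simp]: "fejer g (- x) = fejer g x"
  by (simp add: fejer_def mult.commute)

lemma fejer_0: "g \<noteq> 0 \<Longrightarrow> fejer g 0 = 1"
  by (simp add: fejer_def geom_char_def power2_eq_square)

text \<open>Here \<open>char1 x\<close> is a \<open>g\<close>-th root of unity other than 1, so its powers sum to zero.\<close>

lemma fejer_eq_0:
  assumes "x \<notin> \<int>" and "of_nat g * x \<in> \<int>"
  shows "fejer g x = 0"
proof -
  have "char1 x \<noteq> 1" "char1 x ^ g = 1"
    using assms by (simp_all add: char1_eq_1_iff flip: char1_of_nat_mult)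
  then have "geom_char g x = 0"
    by (simp add: geom_char_def char1_of_nat_mult geometric_sum)
  then show ?thesis
    by (simp add: fejer_def)
qed

lemma trig_poly_fejer: "trig_poly (\<lambda>\<xi>. fejer g (\<xi> $ i))"
proof -
  have inner: "real_vec (axis i k) \<bullet> \<xi> = of_int k * \<xi> $ i" for k and \<xi> :: "real^2"
  proof -
    have "real_vec (axis i k) = axis i (of_int k)"
      by (simp add: vec_eq_iff axis_def)
    then show ?thesis
      by (simp add: inner_axis')
  qed
  have geom: "trig_poly (\<lambda>\<xi>. geom_char g (of_int \<sigma> * \<xi> $ i))" for \<sigma>
  proof (rule trig_polyI)
    show "geom_char g (of_int \<sigma> * \<xi> $ i)
        = (\<Sum>j<g. 1 * char1 (real_vec (axis i (int j * \<sigma>)) \<bullet> \<xi>))" for \<xi>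
      unfolding geom_char_def inner by (simp add: mult_ac)
  qed simp
  have "trig_poly (\<lambda>\<xi>. geom_char g (of_int 1 * \<xi> $ i) * geom_char g (of_int (- 1) * \<xi> $ i)
      * (1 / of_nat g ^ 2))"
    by (intro trig_poly_mult geom trig_poly_const)
  then show ?thesis
    by (simp add: fejer_def)
qed

section \<open>Diagonal dilations\<close>

abbreviation diag_mat2 :: "'a::zero \<Rightarrow> 'a \<Rightarrow> 'a^2^2" where
  "diag_mat2 a b \<equiv> vector [vector [a, 0], vector [0, b]]"

lemma diag_mat2_mult_vector:
  fixes a b :: "'a::comm_semiring_1"
  shows "(diag_mat2 a b *v x) $ 1 = a * x $ 1" "(diag_mat2 a b *v x) $ 2 = b * x $ 2"
  by (simp_all add: matrix_vector_mult_def sum_2)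

lemma transpose_diag_mat2: "transpose (diag_mat2 a b) = diag_mat2 a b"
  by (simp add: vec_eq_iff forall_2 transpose_def)

lemma map_matrix_diag_mat2: "f 0 = 0 \<Longrightarrow> map_matrix f (diag_mat2 a b) = diag_mat2 (f a) (f b)"
  by (simp add: vec_eq_iff forall_2 map_matrix_def)

text \<open>The diagonal entries are eigenvalues, with the standard basis vectors as eigenvectors.\<close>

lemma diag_matrix_dilation_nonzero:
  assumes "matrix_dilation (diag_mat2 a b)"
  shows "a \<noteq> 0" "b \<noteq> 0"
proof -
  have "eigenvalue (diag_mat2 (of_int a) (of_int b)) (of_int a)"
    unfolding eigenvalue_def
    by (rule exI [of _ "axis 1 1"]) (simp add: vec_eq_iff forall_2 diag_mat2_mult_vector axis_def)
  moreover have "eigenvalue (diag_mat2 (of_int a) (of_int b)) (of_int b)"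
    unfolding eigenvalue_def
    by (rule exI [of _ "axis 2 1"]) (simp add: vec_eq_iff forall_2 diag_mat2_mult_vector axis_def)
  ultimately have "cmod (of_int a) > 1" "cmod (of_int b) > 1"
    using assms unfolding matrix_dilation_def map_matrix_diag_mat2 [of complex_of_int, OF of_int_0]
    by blast+
  then show "a \<noteq> 0" "b \<noteq> 0" by auto
qed

lemma matrix_inv_diag_mat2:
  fixes a b :: real
  assumes "a \<noteq> 0" "b \<noteq> 0"
  shows "(matrix_inv (diag_mat2 a b) *v x) $ 1 = x $ 1 / a"
    and "(matrix_inv (diag_mat2 a b) *v x) $ 2 = x $ 2 / b"
proof -
  define y where "y = matrix_inv (diag_mat2 a b) *v x"
  have "invertible (diag_mat2 a b)"
    using assms by (simp add: invertible_det_nz det_2)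
  then have "diag_mat2 a b ** matrix_inv (diag_mat2 a b) = mat 1"
    unfolding invertible_def matrix_inv_def by (rule someI2_ex) simp
  then have "diag_mat2 a b *v y = x"
    by (simp add: y_def matrix_vector_mul_assoc)
  then have "a * y $ 1 = x $ 1" "b * y $ 2 = x $ 2"
    using diag_mat2_mult_vector [of a b y] by simp_all
  then show "(matrix_inv (diag_mat2 a b) *v x) $ 1 = x $ 1 / a"
    and "(matrix_inv (diag_mat2 a b) *v x) $ 2 = x $ 2 / b"
    using assms by (simp_all add: y_def [symmetric] field_simps)
qed

text \<open>The class of 0 is already represented by the digit 0.\<close>

lemma digit_set_not_in_lattice:
  assumes "digit_set A D" "s \<in> D - {0}"
  shows "s \<noteq> A *v z"
proof
  assume "s = A *v z"
  then have "\<exists>z. s - 0 = A *v z" by auto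
  moreover have "\<exists>z. s - s = A *v z" by (intro exI [of _ 0]) simp
  ultimately show False
    using assms unfolding digit_set_def by blast
qed

lemma fejer_div_eq_0:
  assumes "\<gamma> \<noteq> 0" "\<not> \<gamma> dvd s"
  shows "fejer (nat \<bar>\<gamma>\<bar>) (of_int s / of_int \<gamma>) = 0"
proof (rule fejer_eq_0)
  show "of_int s / of_int \<gamma> \<notin> (\<int> :: real set)"
  proof
    assume "of_int s / of_int \<gamma> \<in> (\<int> :: real set)"
    then obtain k :: int where "of_int s / of_int \<gamma> = (of_int k :: real)"
      by (auto elim: Ints_cases)
    then have "of_int s = (of_int (k * \<gamma>) :: real)"
      using assms(1) by (simp add: field_simps)
    then have "s = k * \<gamma>"
      unfolding of_int_eq_iff .
    with assms(2) show False by simp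
  qed
  have "of_nat (nat \<bar>\<gamma>\<bar>) * (of_int s / of_int \<gamma>) = (of_int (sgn \<gamma> * s) :: real)"
    using assms(1) by (simp add: sgn_if)
  then show "of_nat (nat \<bar>\<gamma>\<bar>) * (of_int s / of_int \<gamma>) \<in> (\<int> :: real set)"
    by (metis Ints_of_int)
qed

theorem theorem24:
  fixes \<gamma>1 \<gamma>2 :: int and M :: "int^2^2" and n :: nat
  assumes M: "M = vector [vector [\<gamma>1, 0], vector [0, \<gamma>2]]"
    and dilation: "matrix_dilation M"
  shows "\<exists>m0. is_mask m0 \<and> axial_symmetric m0 0 \<and> sum_rule M n m0"
proof -
  have nz: "\<gamma>1 \<noteq> 0" "\<gamma>2 \<noteq> 0"
    using dilation diag_matrix_dilation_nonzero unfolding M by blast+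
  define P where "P \<xi> = fejer (nat \<bar>\<gamma>1\<bar>) (\<xi> $ 1) * fejer (nat \<bar>\<gamma>2\<bar>) (\<xi> $ 2)" for \<xi> :: "real^2"
  have P: "trig_poly P"
    unfolding P_def by (intro trig_poly_mult trig_poly_fejer)
  have "is_mask (\<lambda>\<xi>. P \<xi> ^ n)"
    using nz by (simp add: is_mask_def trig_poly_power P) (simp add: P_def fejer_0)
  moreover have "axial_symmetric (\<lambda>\<xi>. P \<xi> ^ n) 0"
  proof -
    have even: "P \<eta> = P \<xi>" if "\<bar>\<eta> $ 1\<bar> = \<bar>\<xi> $ 1\<bar>" "\<bar>\<eta> $ 2\<bar> = \<bar>\<xi> $ 2\<bar>" for \<xi> \<eta>
      using that by (auto simp: P_def abs_eq_iff)
    have "P (real_mat (transpose E) *v \<xi>) = P \<xi>" if "E \<in> G_axis" for E \<xi>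
      using that
      by (intro even)
        (auto simp: G_axis_def Y_mat_def matrix_vector_mult_def sum_2 transpose_def map_matrix_def
          mat_def)
    moreover have "0 = (1/2) *\<^sub>R real_vec 0"
      by (simp add: vec_eq_iff)
    ultimately show ?thesis
      unfolding axial_symmetric_def by (auto intro!: exI [of _ 0])
  qed
  moreover have "sum_rule M n (\<lambda>\<xi>. P \<xi> ^ n)"
    unfolding sum_rule_def
  proof (intro allI impI ballI)
    fix D s and \<beta> :: "nat^2"
    assume D: "digit_set (transpose M) D" and s: "s \<in> D - {0}" and \<beta>: "\<beta> $ 1 + \<beta> $ 2 < n"
    define N where "N = matrix_inv (real_mat (transpose M))"
    have "\<not> (\<gamma>1 dvd s $ 1 \<and> \<gamma>2 dvd s $ 2)"
    proof
      assume "\<gamma>1 dvd s $ 1 \<and> \<gamma>2 dvd s $ 2"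
      then obtain k l where "s $ 1 = \<gamma>1 * k" "s $ 2 = \<gamma>2 * l"
        by (auto elim!: dvdE)
      then have "s = transpose M *v vector [k, l]"
        by (simp add: M transpose_diag_mat2 vec_eq_iff forall_2 diag_mat2_mult_vector)
      then show False
        using digit_set_not_in_lattice [OF D s] by blast
    qed
    then have "P (N *v real_vec s) = 0"
      using nz fejer_div_eq_0 [of \<gamma>1 "s $ 1"] fejer_div_eq_0 [of \<gamma>2 "s $ 2"]
      by (auto simp: P_def N_def M transpose_diag_mat2 map_matrix_diag_mat2 matrix_inv_diag_mat2)
    then show "multi_deriv \<beta> (\<lambda>\<xi>. P (matrix_inv (real_mat (transpose M)) *v \<xi>) ^ n)
        (real_vec s) = 0"
      unfolding N_def [symmetric]
      by (intro multi_deriv_power_eq_0 exp_poly_matrix_vector_mult trig_poly_imp_exp_poly P \<beta>)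
  qed
  ultimately show ?thesis by blast
qed

end
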